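(* Let $p,q\in\mathbb{N}$. There is a natural transformation $\Theta_{p,q}:\Delta^p\star\Delta^q\longrightarrow\Delta^{pq}$ of simplicial sets induced by $\delta_{p,q}$, namely the one whose component at $[r]$ is $$\Theta_{[r]}\big([\pi;\alpha,\beta]\big) = \delta_{p,q;[r]}\big(P(\alpha,\beta;[r])(\pi)\big)$$ for $\pi\in P([x],[y];[r])$, $\alpha:[x]\to[p]$, $\beta:[y]\to[q]$, and it agrees with the Hadamard map $H_{p,q}:\Delta^p\times\Delta^q\to\Delta^{pq}$ under the canonical identification $\Delta^p\star\Delta^q\cong\Delta^p\times\Delta^q$.
   Context: The simplex category $\Delta$ has objects the finite ordinals $[n]=\{0<1<\cdots<n\}$ for $n\in\mathbb{N}$ (including $n=0$) and morphisms the nondecreasing maps. Simplicial sets are functors $\Delta^{\mathrm{op}}\to\mathbf{Set}$, and $\Delta^n := \Delta(-,[n])$ denotes the representable simplicial set. The kernel $P:\Delta\times\Delta\times\Delta^{\mathrm{op}}\to\mathbf{Set}$ is the coend $$P([p],[q];[r]) := \int^{[m]\in\Delta} \Delta([m],[p])\times\Delta([m],[q])\times\Delta([r],[m]),$$ with action on morphisms by composition in the respective factors. Thus an element is an equivalence class $[\sigma,\tau,\gamma]$ of triples $(\sigma:[m]\to[p],\tau:[m]\to[q],\gamma:[r]\to[m])$ under the equivalence relation generated by $[\sigma\circ f,\tau\circ f,\gamma]\sim[\sigma,\tau,f\circ\gamma]$ for $f:[m']\to[m]$; and $P(\alpha,\beta;[r])$ sends $[\sigma,\tau,\gamma]$ to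 $[\alpha\circ\sigma,\beta\circ\tau,\gamma]$. For simplicial sets $F,G$, the Day convolution is $$(F\star G)([r]) := \int^{[x],[y]\in\Delta} P([x],[y];[r])\times F([x])\times G([y]).$$ An element of $(\Delta^p\star\Delta^q)([r])$ is thus a class $[\pi;\alpha,\beta]$ with $\pi\in P([x],[y];[r])$, $\alpha:[x]\to[p]$, $\beta:[y]\to[q]$. The Hadamard product of $\alpha\in\Delta([m],[p])$ and $\beta\in\Delta([m],[q])$ is $\alpha\boxtimes\beta\in\Delta([m],[pq])$, $(\alpha\boxtimes\beta)(t):=\alpha(t)\cdot\beta(t)$ for $0\le t\le m$. The Hadamard map $H_{p,q}:\Delta^p\times\Delta^q\to\Delta^{pq}$ is the map of simplicial sets given at level $[m]$ by $(\alpha,\beta)\mapsto\alpha\boxtimes\beta$. The natural transformation $\delta_{p,q}:P([p],[q];-)\to\Delta(-,[pq])$ has components $\delta_{p,q;[r]}[\sigma,\tau,\gamma]=(\sigma\boxtimes\tau)\circ\gamma$. The canonical identification $\Delta^p\star\Delta^q\cong\Delta^p\times\Delta^q$ is the composite of co-Yoneda isomorphisms $(\Delta^p\star\Delta^q)([r])\cong P([p],[q];[r])\cong\Delta([r],[p])\times\Delta([r],[q])$, where the first sends $[\pi;\alpha,\beta]$ to $P(\alpha,\beta;[r])(\pi)$ and the second sends $[\sigma,\tau,\gamma]$ to $(\sigma\circ\gamma,\tau\circ\gamma)$. *)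

theory Defs
  imports Main "HOL-Library.FuncSet"
begin

section \<open>The simplex category\<close>

text \<open>The object \<open>[n]\<close> is encoded by the natural number \<open>n\<close>, its underlying set being \<open>{..n}\<close>.
  Monotone maps are extensional (undefined outside their domain), so that equality of morphisms is
  equality in HOL; the composite of \<open>f : [k] \<rightarrow> [m]\<close> and \<open>g : [m] \<rightarrow> [n]\<close> is \<open>compose {..k} g f\<close>.\<close>

definition Delta :: "nat \<Rightarrow> nat \<Rightarrow> (nat \<Rightarrow> nat) set" where
  "Delta m n = {f \<in> {..m} \<rightarrow>\<^sub>E {..n}. mono_on {..m} f}"

definition Delta_id :: "nat \<Rightarrow> nat \<Rightarrow> nat" where
  "Delta_id n = (\<lambda>t\<in>{..n}. t)"

lemma Delta_id_in [simp]: "Delta_id n \<in> Delta n n"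
  by (auto simp: Delta_def Delta_id_def monotone_on_def)

lemma Delta_comp_in:
  assumes "f \<in> Delta k m" "g \<in> Delta m n"
  shows "compose {..k} g f \<in> Delta k n"
  using assms unfolding Delta_def compose_def
  by (auto simp: PiE_iff monotone_on_def)

lemma Delta_funcset: "f \<in> Delta m n \<Longrightarrow> f \<in> {..m} \<rightarrow> {..n}"
  by (auto simp: Delta_def)

lemma Delta_comp_id_right [simp]: "f \<in> Delta m n \<Longrightarrow> compose {..m} f (Delta_id m) = f"
  by (auto simp: Delta_def Delta_id_def compose_def PiE_iff extensional_def fun_eq_iff)

lemma Delta_comp_id_left [simp]: "f \<in> Delta m n \<Longrightarrow> compose {..m} (Delta_id n) f = f"
  by (auto simp: Delta_def Delta_id_def compose_def PiE_iff extensional_def fun_eq_iff)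

lemma Delta_comp_assoc:
  "f \<in> Delta k m \<Longrightarrow> compose {..k} h (compose {..k} g f) = compose {..k} (compose {..m} h g) f"
  by (rule compose_assoc) (rule Delta_funcset)


section \<open>Simplicial sets\<close>

record 'a sset =
  level :: "nat \<Rightarrow> 'a set"
  act :: "nat \<Rightarrow> nat \<Rightarrow> (nat \<Rightarrow> nat) \<Rightarrow> 'a \<Rightarrow> 'a"

text \<open>For \<open>f : [m] \<rightarrow> [n]\<close>, the map \<open>X(f) : X([n]) \<rightarrow> X([m])\<close> is \<open>act X m n f\<close>.\<close>

definition simplicial_set :: "'a sset \<Rightarrow> bool" where
  "simplicial_set X \<longleftrightarrow>
     (\<forall>m n. \<forall>f\<in>Delta m n. act X m n f \<in> level X n \<rightarrow> level X m) \<and>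
     (\<forall>n. \<forall>x\<in>level X n. act X n n (Delta_id n) x = x) \<and>
     (\<forall>k m n. \<forall>f\<in>Delta k m. \<forall>g\<in>Delta m n. \<forall>x\<in>level X n.
        act X k n (compose {..k} g f) x = act X k m f (act X m n g x))"

text \<open>The components of a natural transformation are extensional functions.\<close>

definition sset_hom :: "'a sset \<Rightarrow> 'b sset \<Rightarrow> (nat \<Rightarrow> 'a \<Rightarrow> 'b) set" where
  "sset_hom X Y = {\<theta>. (\<forall>n. \<theta> n \<in> level X n \<rightarrow>\<^sub>E level Y n) \<and>
     (\<forall>m n. \<forall>f\<in>Delta m n. \<forall>x\<in>level X n. \<theta> m (act X m n f x) = act Y m n f (\<theta> n x))}"

definition sset_comp ::
  "'a sset \<Rightarrow> (nat \<Rightarrow> 'b \<Rightarrow> 'c) \<Rightarrow> (nat \<Rightarrow> 'a \<Rightarrow> 'b) \<Rightarrow> nat \<Rightarrow> 'a \<Rightarrow> 'c" where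
  "sset_comp X \<eta> \<theta> = (\<lambda>n. compose (level X n) (\<eta> n) (\<theta> n))"

definition sset_iso :: "'a sset \<Rightarrow> 'b sset \<Rightarrow> (nat \<Rightarrow> 'a \<Rightarrow> 'b) set" where
  "sset_iso X Y = {\<theta> \<in> sset_hom X Y. \<forall>n. bij_betw (\<theta> n) (level X n) (level Y n)}"

definition representable :: "nat \<Rightarrow> (nat \<Rightarrow> nat) sset" where
  "representable n = \<lparr>level = (\<lambda>m. Delta m n), act = (\<lambda>k m f \<alpha>. compose {..k} \<alpha> f)\<rparr>"

definition sset_prod :: "'a sset \<Rightarrow> 'b sset \<Rightarrow> ('a \<times> 'b) sset" where
  "sset_prod X Y = \<lparr>level = (\<lambda>n. level X n \<times> level Y n),
     act = (\<lambda>m n f (x, y). (act X m n f x, act Y m n f y))\<rparr>"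

lemma simplicial_setD:
  assumes "simplicial_set X"
  shows "f \<in> Delta m n \<Longrightarrow> x \<in> level X n \<Longrightarrow> act X m n f x \<in> level X m"
    and "x \<in> level X n \<Longrightarrow> act X n n (Delta_id n) x = x"
    and "f \<in> Delta k m \<Longrightarrow> g \<in> Delta m n \<Longrightarrow> x \<in> level X n \<Longrightarrow>
        act X k n (compose {..k} g f) x = act X k m f (act X m n g x)"
  using assms unfolding simplicial_set_def by blast+

lemma simplicial_set_representable: "simplicial_set (representable n)"
  unfolding simplicial_set_def representable_def
  by (auto intro: Delta_comp_in simp: Delta_comp_assoc)

lemma simplicial_set_prod:
  "simplicial_set X \<Longrightarrow> simplicial_set Y \<Longrightarrow> simplicial_set (sset_prod X Y)"
  unfolding simplicial_set_def sset_prod_def by (auto simp: Pi_iff)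

lemma sset_comp_hom:
  assumes X: "simplicial_set X" and "\<theta> \<in> sset_hom X Y" "\<eta> \<in> sset_hom Y Z"
  shows "sset_comp X \<eta> \<theta> \<in> sset_hom X Z"
  using assms(2,3) simplicial_setD(1)[OF X]
  unfolding sset_hom_def sset_comp_def
  by (auto simp: compose_def PiE_iff)

lemma sset_comp_iso:
  assumes X: "simplicial_set X" and "\<theta> \<in> sset_iso X Y" "\<eta> \<in> sset_iso Y Z"
  shows "sset_comp X \<eta> \<theta> \<in> sset_iso X Z"
  using assms sset_comp_hom[OF X] unfolding sset_iso_def
  by (auto simp: sset_comp_def intro: bij_betw_compose)


section \<open>Coends of sets\<close>

text \<open>For a set-valued functor \<open>T\<close>, contravariant in its first and covariant in its second argument,
  the coend is the quotient of the disjoint union of the sets \<open>T i i\<close> by the equivalence relation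
  generated by \<open>T(f, 1)(z) \<sim> T(1, f)(z)\<close> for \<open>f : i \<rightarrow> j\<close> and \<open>z \<in> T j i\<close>.  Here \<open>L i j f\<close> is
  \<open>T(f, 1) : T j i \<rightarrow> T i i\<close> and \<open>R i j f\<close> is \<open>T(1, f) : T j i \<rightarrow> T j j\<close>; every element of
  the type \<open>'i\<close> is an object of the indexing category.\<close>

definition coend_rel ::
  "('i \<Rightarrow> 'i \<Rightarrow> 'f set) \<Rightarrow> ('i \<Rightarrow> 'i \<Rightarrow> 'a set) \<Rightarrow> ('i \<Rightarrow> 'i \<Rightarrow> 'f \<Rightarrow> 'a \<Rightarrow> 'a) \<Rightarrow>
   ('i \<Rightarrow> 'i \<Rightarrow> 'f \<Rightarrow> 'a \<Rightarrow> 'a) \<Rightarrow> (('i \<times> 'a) \<times> ('i \<times> 'a)) set" where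
  "coend_rel Hom T L R =
     (let A = (SIGMA i:UNIV. T i i);
          G = {((i, L i j f z), (j, R i j f z)) | i j f z. f \<in> Hom i j \<and> z \<in> T j i}
      in (G \<union> G\<inverse>)\<^sup>* \<inter> A \<times> A)"

definition coend ::
  "('i \<Rightarrow> 'i \<Rightarrow> 'f set) \<Rightarrow> ('i \<Rightarrow> 'i \<Rightarrow> 'a set) \<Rightarrow> ('i \<Rightarrow> 'i \<Rightarrow> 'f \<Rightarrow> 'a \<Rightarrow> 'a) \<Rightarrow>
   ('i \<Rightarrow> 'i \<Rightarrow> 'f \<Rightarrow> 'a \<Rightarrow> 'a) \<Rightarrow> ('i \<times> 'a) set set" where
  "coend Hom T L R = (SIGMA i:UNIV. T i i) // coend_rel Hom T L R"

text \<open>The value on a class of a function that is constant on equivalence classes.\<close>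

definition on_class :: "('a \<Rightarrow> 'b) \<Rightarrow> 'a set \<Rightarrow> 'b" where
  "on_class h c = the_elem (h ` c)"

lemma coend_rel_equiv: "equiv (SIGMA i:UNIV. T i i) (coend_rel Hom T L R)"
proof -
  define A where "A = (SIGMA i:UNIV. T i i)"
  define G where "G = {((i, L i j f z), (j, R i j f z)) | i j f z. f \<in> Hom i j \<and> z \<in> T j i}"
  have "sym ((G \<union> G\<inverse>)\<^sup>*)"
    by (rule sym_rtrancl) (auto simp: sym_def)
  moreover have "trans ((G \<union> G\<inverse>)\<^sup>*)"
    by (rule trans_rtrancl)
  ultimately have "equiv A ((G \<union> G\<inverse>)\<^sup>* \<inter> A \<times> A)"
    unfolding equiv_def refl_on_def by (auto simp: sym_def intro!: transI dest: transD)
  then show ?thesis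
    unfolding coend_rel_def A_def G_def Let_def .
qed

lemma coend_relI:
  assumes "f \<in> Hom i j" "z \<in> T j i" "L i j f z \<in> T i i" "R i j f z \<in> T j j"
  shows "coend_rel Hom T L R `` {(i, L i j f z)} = coend_rel Hom T L R `` {(j, R i j f z)}"
proof (rule equiv_class_eq[OF coend_rel_equiv])
  show "((i, L i j f z), (j, R i j f z)) \<in> coend_rel Hom T L R"
    using assms unfolding coend_rel_def Let_def by (blast intro: r_into_rtrancl)
qed

lemma coend_classI: "a \<in> T i i \<Longrightarrow> coend_rel Hom T L R `` {(i, a)} \<in> coend Hom T L R"
  unfolding coend_def by (auto intro: quotientI)

lemma coend_classE:
  assumes "c \<in> coend Hom T L R"
  obtains i a where "a \<in> T i i" "c = coend_rel Hom T L R `` {(i, a)}"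
  using assms unfolding coend_def by (auto elim!: quotientE)

lemma on_class_coend:
  assumes inv: "\<And>i j f z. f \<in> Hom i j \<Longrightarrow> z \<in> T j i \<Longrightarrow> h (i, L i j f z) = h (j, R i j f z)"
    and a: "a \<in> T i i"
  shows "on_class h (coend_rel Hom T L R `` {(i, a)}) = h (i, a)"
proof -
  define G where "G = {((i, L i j f z), (j, R i j f z)) | i j f z. f \<in> Hom i j \<and> z \<in> T j i}"
  have 1: "h u = h v" if "(u, v) \<in> (G \<union> G\<inverse>)\<^sup>*" for u v
    using that
  proof induction
    case (step v w)
    then show ?case unfolding G_def using inv by auto
  qed simp
  have "h ` (coend_rel Hom T L R `` {(i, a)}) = {h (i, a)}"
  proof -
    have "(i, a) \<in> coend_rel Hom T L R `` {(i, a)}"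
      using a unfolding coend_rel_def Let_def by auto
    moreover have "h v = h (i, a)" if "v \<in> coend_rel Hom T L R `` {(i, a)}" for v
      using that 1[of "(i, a)" v] unfolding coend_rel_def Let_def G_def by auto
    ultimately show ?thesis by blast
  qed
  then show ?thesis
    unfolding on_class_def by simp
qed


section \<open>The kernel\<close>

type_synonym kernel_elem = "(nat \<times> (nat \<Rightarrow> nat) \<times> (nat \<Rightarrow> nat) \<times> (nat \<Rightarrow> nat)) set"

definition kernel_T ::
  "nat \<Rightarrow> nat \<Rightarrow> nat \<Rightarrow> nat \<Rightarrow> nat \<Rightarrow> ((nat \<Rightarrow> nat) \<times> (nat \<Rightarrow> nat) \<times> (nat \<Rightarrow> nat)) set" where
  "kernel_T p q r m n = Delta m p \<times> Delta m q \<times> Delta r n"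

definition kernel_L :: "nat \<Rightarrow> nat \<Rightarrow> (nat \<Rightarrow> nat) \<Rightarrow> (nat \<Rightarrow> nat) \<times> (nat \<Rightarrow> nat) \<times> (nat \<Rightarrow> nat) \<Rightarrow>
    (nat \<Rightarrow> nat) \<times> (nat \<Rightarrow> nat) \<times> (nat \<Rightarrow> nat)" where
  "kernel_L m n f = (\<lambda>(\<sigma>, \<tau>, \<gamma>). (compose {..m} \<sigma> f, compose {..m} \<tau> f, \<gamma>))"

definition kernel_R :: "nat \<Rightarrow> nat \<Rightarrow> nat \<Rightarrow> (nat \<Rightarrow> nat) \<Rightarrow>
    (nat \<Rightarrow> nat) \<times> (nat \<Rightarrow> nat) \<times> (nat \<Rightarrow> nat) \<Rightarrow> (nat \<Rightarrow> nat) \<times> (nat \<Rightarrow> nat) \<times> (nat \<Rightarrow> nat)" where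
  "kernel_R r m n f = (\<lambda>(\<sigma>, \<tau>, \<gamma>). (\<sigma>, \<tau>, compose {..r} f \<gamma>))"

text \<open>\<open>kernel_set p q r\<close> is the set \<open>P([p],[q];[r])\<close>; \<open>kernel_class p q r m \<sigma> \<tau> \<gamma>\<close> is the class
  \<open>[\<sigma>, \<tau>, \<gamma>]\<close> of a triple with middle object \<open>[m]\<close>.\<close>

definition kernel_set :: "nat \<Rightarrow> nat \<Rightarrow> nat \<Rightarrow> kernel_elem set" where
  "kernel_set p q r = coend Delta (kernel_T p q r) kernel_L (kernel_R r)"

definition kernel_class ::
  "nat \<Rightarrow> nat \<Rightarrow> nat \<Rightarrow> nat \<Rightarrow> (nat \<Rightarrow> nat) \<Rightarrow> (nat \<Rightarrow> nat) \<Rightarrow> (nat \<Rightarrow> nat) \<Rightarrow> kernel_elem" where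
  "kernel_class p q r m \<sigma> \<tau> \<gamma> =
     coend_rel Delta (kernel_T p q r) kernel_L (kernel_R r) `` {(m, \<sigma>, \<tau>, \<gamma>)}"

text \<open>For \<open>\<alpha> : [p] \<rightarrow> [p']\<close>, \<open>\<beta> : [q] \<rightarrow> [q']\<close> and \<open>\<rho> : [r'] \<rightarrow> [r]\<close>, the map
  \<open>P(\<alpha>, \<beta>; \<rho>) : P([p],[q];[r]) \<rightarrow> P([p'],[q'];[r'])\<close> is \<open>kernel_act p' q' r' \<alpha> \<beta> \<rho>\<close>.
  As usual, \<open>P(\<alpha>, \<beta>; [r])\<close> stands for \<open>P(\<alpha>, \<beta>; id)\<close>.\<close>

definition kernel_act :: "nat \<Rightarrow> nat \<Rightarrow> nat \<Rightarrow> (nat \<Rightarrow> nat) \<Rightarrow> (nat \<Rightarrow> nat) \<Rightarrow> (nat \<Rightarrow> nat) \<Rightarrow>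
    kernel_elem \<Rightarrow> kernel_elem" where
  "kernel_act p' q' r' \<alpha> \<beta> \<rho> = on_class (\<lambda>(m, \<sigma>, \<tau>, \<gamma>).
     kernel_class p' q' r' m (compose {..m} \<alpha> \<sigma>) (compose {..m} \<beta> \<tau>) (compose {..r'} \<gamma> \<rho>))"

definition kernel_sset :: "nat \<Rightarrow> nat \<Rightarrow> kernel_elem sset" where
  "kernel_sset p q = \<lparr>level = (\<lambda>r. kernel_set p q r),
     act = (\<lambda>r' r \<rho>. kernel_act p q r' (Delta_id p) (Delta_id q) \<rho>)\<rparr>"

lemma kernel_classI:
  "\<sigma> \<in> Delta m p \<Longrightarrow> \<tau> \<in> Delta m q \<Longrightarrow> \<gamma> \<in> Delta r m \<Longrightarrow> kernel_class p q r m \<sigma> \<tau> \<gamma> \<in> kernel_set p q r"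
  unfolding kernel_class_def kernel_set_def by (rule coend_classI) (simp add: kernel_T_def)

lemma kernelE:
  assumes "\<pi> \<in> kernel_set p q r"
  obtains m \<sigma> \<tau> \<gamma> where "\<sigma> \<in> Delta m p" "\<tau> \<in> Delta m q" "\<gamma> \<in> Delta r m"
    "\<pi> = kernel_class p q r m \<sigma> \<tau> \<gamma>"
  using assms unfolding kernel_class_def kernel_set_def
  by (elim coend_classE) (auto simp: kernel_T_def)

lemma kernel_class_eq:
  assumes "f \<in> Delta m n" "\<sigma> \<in> Delta n p" "\<tau> \<in> Delta n q" "\<gamma> \<in> Delta r m"
  shows "kernel_class p q r m (compose {..m} \<sigma> f) (compose {..m} \<tau> f) \<gamma> =
    kernel_class p q r n \<sigma> \<tau> (compose {..r} f \<gamma>)"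
  using coend_relI[of f Delta m n "(\<sigma>, \<tau>, \<gamma>)" "kernel_T p q r" kernel_L "kernel_R r"] assms
  unfolding kernel_class_def by (simp add: kernel_T_def kernel_L_def kernel_R_def Delta_comp_in)

lemma on_class_kernel:
  assumes "\<And>m n f \<sigma> \<tau> \<gamma>. f \<in> Delta m n \<Longrightarrow> \<sigma> \<in> Delta n p \<Longrightarrow> \<tau> \<in> Delta n q \<Longrightarrow> \<gamma> \<in> Delta r m \<Longrightarrow>
      h (m, compose {..m} \<sigma> f, compose {..m} \<tau> f, \<gamma>) = h (n, \<sigma>, \<tau>, compose {..r} f \<gamma>)"
    and "\<sigma> \<in> Delta m p" "\<tau> \<in> Delta m q" "\<gamma> \<in> Delta r m"
  shows "on_class h (kernel_class p q r m \<sigma> \<tau> \<gamma>) = h (m, \<sigma>, \<tau>, \<gamma>)"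
  unfolding kernel_class_def using assms
  by (intro on_class_coend) (auto simp: kernel_T_def kernel_L_def kernel_R_def)

lemma kernel_act_class:
  assumes ab: "\<alpha> \<in> Delta p p'" "\<beta> \<in> Delta q q'" "\<rho> \<in> Delta r' r"
    and "\<sigma> \<in> Delta m p" "\<tau> \<in> Delta m q" "\<gamma> \<in> Delta r m"
  shows "kernel_act p' q' r' \<alpha> \<beta> \<rho> (kernel_class p q r m \<sigma> \<tau> \<gamma>) =
    kernel_class p' q' r' m (compose {..m} \<alpha> \<sigma>) (compose {..m} \<beta> \<tau>) (compose {..r'} \<gamma> \<rho>)"
  unfolding kernel_act_def
proof (subst on_class_kernel)
  fix m n f \<sigma> \<tau> \<gamma>
  assume *: "f \<in> Delta m n" "\<sigma> \<in> Delta n p" "\<tau> \<in> Delta n q" "\<gamma> \<in> Delta r m"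
  then show "(case (m, compose {..m} \<sigma> f, compose {..m} \<tau> f, \<gamma>) of (m, \<sigma>, \<tau>, \<gamma>) \<Rightarrow>
       kernel_class p' q' r' m (compose {..m} \<alpha> \<sigma>) (compose {..m} \<beta> \<tau>) (compose {..r'} \<gamma> \<rho>)) =
     (case (n, \<sigma>, \<tau>, compose {..r} f \<gamma>) of (m, \<sigma>, \<tau>, \<gamma>) \<Rightarrow>
       kernel_class p' q' r' m (compose {..m} \<alpha> \<sigma>) (compose {..m} \<beta> \<tau>) (compose {..r'} \<gamma> \<rho>))"
    using ab kernel_class_eq[of f m n "compose {..n} \<alpha> \<sigma>" p' "compose {..n} \<beta> \<tau>" q'
        "compose {..r'} \<gamma> \<rho>" r']
    by (simp add: Delta_comp_in Delta_comp_assoc)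
qed (use assms in auto)

lemma kernel_act_in:
  assumes "\<alpha> \<in> Delta p p'" "\<beta> \<in> Delta q q'" "\<rho> \<in> Delta r' r" "\<pi> \<in> kernel_set p q r"
  shows "kernel_act p' q' r' \<alpha> \<beta> \<rho> \<pi> \<in> kernel_set p' q' r'"
  using assms(4)
  by (rule kernelE)
    (use assms in \<open>auto simp: kernel_act_class intro!: kernel_classI intro: Delta_comp_in\<close>)

lemma kernel_act_id:
  assumes "\<pi> \<in> kernel_set p q r"
  shows "kernel_act p q r (Delta_id p) (Delta_id q) (Delta_id r) \<pi> = \<pi>"
  using assms by (rule kernelE) (auto simp: kernel_act_class)

lemma kernel_act_comp:
  assumes "\<alpha> \<in> Delta p p'" "\<beta> \<in> Delta q q'" "\<rho> \<in> Delta r' r"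
    and "\<alpha>' \<in> Delta p' p''" "\<beta>' \<in> Delta q' q''" "\<rho>' \<in> Delta r'' r'" "\<pi> \<in> kernel_set p q r"
  shows "kernel_act p'' q'' r'' \<alpha>' \<beta>' \<rho>' (kernel_act p' q' r' \<alpha> \<beta> \<rho> \<pi>) =
    kernel_act p'' q'' r'' (compose {..p} \<alpha>' \<alpha>) (compose {..q} \<beta>' \<beta>) (compose {..r''} \<rho> \<rho>') \<pi>"
  using assms(7)
proof (rule kernelE)
  fix m \<sigma> \<tau> \<gamma>
  assume "\<sigma> \<in> Delta m p" "\<tau> \<in> Delta m q" "\<gamma> \<in> Delta r m" "\<pi> = kernel_class p q r m \<sigma> \<tau> \<gamma>"
  then show ?thesis
    using assms by (simp add: kernel_act_class[where r=r] kernel_act_class[where r=r']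
        Delta_comp_in Delta_comp_assoc)
qed

lemma simplicial_set_kernel: "simplicial_set (kernel_sset p q)"
  unfolding simplicial_set_def kernel_sset_def
  by (auto simp: kernel_act_id kernel_act_comp[where p=p and q=q and p'=p and q'=q]
      intro: kernel_act_in[OF Delta_id_in Delta_id_in])


section \<open>Day convolution\<close>

type_synonym ('a, 'b) day_elem = "((nat \<times> nat) \<times> (kernel_elem \<times> 'a \<times> 'b)) set"

definition day_Hom :: "nat \<times> nat \<Rightarrow> nat \<times> nat \<Rightarrow> ((nat \<Rightarrow> nat) \<times> (nat \<Rightarrow> nat)) set" where
  "day_Hom = (\<lambda>(x, y) (x', y'). Delta x x' \<times> Delta y y')"

definition day_T :: "'a sset \<Rightarrow> 'b sset \<Rightarrow> nat \<Rightarrow> nat \<times> nat \<Rightarrow> nat \<times> nat \<Rightarrow>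
    (kernel_elem \<times> 'a \<times> 'b) set" where
  "day_T F G r = (\<lambda>(x', y') (x, y). kernel_set x y r \<times> level F x' \<times> level G y')"

definition day_L :: "'a sset \<Rightarrow> 'b sset \<Rightarrow> nat \<times> nat \<Rightarrow> nat \<times> nat \<Rightarrow>
    (nat \<Rightarrow> nat) \<times> (nat \<Rightarrow> nat) \<Rightarrow> kernel_elem \<times> 'a \<times> 'b \<Rightarrow> kernel_elem \<times> 'a \<times> 'b" where
  "day_L F G = (\<lambda>(x, y) (x', y') (f, g) (\<pi>, a, b). (\<pi>, act F x x' f a, act G y y' g b))"

definition day_R :: "nat \<Rightarrow> nat \<times> nat \<Rightarrow> nat \<times> nat \<Rightarrow>
    (nat \<Rightarrow> nat) \<times> (nat \<Rightarrow> nat) \<Rightarrow> kernel_elem \<times> 'a \<times> 'b \<Rightarrow> kernel_elem \<times> 'a \<times> 'b" where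
  "day_R r = (\<lambda>(x, y) (x', y') (f, g) (\<pi>, a, b). (kernel_act x' y' r f g (Delta_id r) \<pi>, a, b))"

text \<open>\<open>day_class F G r x y \<pi> a b\<close> is the class \<open>[\<pi>; a, b]\<close> in \<open>(F \<star> G)([r])\<close>.\<close>

definition day_class :: "'a sset \<Rightarrow> 'b sset \<Rightarrow> nat \<Rightarrow> nat \<Rightarrow> nat \<Rightarrow> kernel_elem \<Rightarrow> 'a \<Rightarrow> 'b \<Rightarrow>
    ('a, 'b) day_elem" where
  "day_class F G r x y \<pi> a b =
     coend_rel day_Hom (day_T F G r) (day_L F G) (day_R r) `` {((x, y), \<pi>, a, b)}"

definition day :: "'a sset \<Rightarrow> 'b sset \<Rightarrow> ('a, 'b) day_elem sset" where
  "day F G = \<lparr>level = (\<lambda>r. coend day_Hom (day_T F G r) (day_L F G) (day_R r)),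
     act = (\<lambda>r' r \<rho>. on_class (\<lambda>((x, y), \<pi>, a, b).
        day_class F G r' x y (kernel_act x y r' (Delta_id x) (Delta_id y) \<rho> \<pi>) a b))\<rparr>"

lemma day_classI:
  "\<pi> \<in> kernel_set x y r \<Longrightarrow> a \<in> level F x \<Longrightarrow> b \<in> level G y \<Longrightarrow>
    day_class F G r x y \<pi> a b \<in> level (day F G) r"
  unfolding day_class_def day_def by (simp, rule coend_classI) (simp add: day_T_def)

lemma dayE:
  assumes "z \<in> level (day F G) r"
  obtains x y \<pi> a b where "\<pi> \<in> kernel_set x y r" "a \<in> level F x" "b \<in> level G y"
    "z = day_class F G r x y \<pi> a b"
  using assms unfolding day_class_def day_def
  by (auto elim!: coend_classE simp: day_T_def)

lemma day_class_eq:
  assumes "simplicial_set F" "simplicial_set G" "f \<in> Delta x x'" "g \<in> Delta y y'"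
    "\<pi> \<in> kernel_set x y r" "a \<in> level F x'" "b \<in> level G y'"
  shows "day_class F G r x y \<pi> (act F x x' f a) (act G y y' g b) =
    day_class F G r x' y' (kernel_act x' y' r f g (Delta_id r) \<pi>) a b"
  using coend_relI[of "(f, g)" day_Hom "(x, y)" "(x', y')" "(\<pi>, a, b)"
      "day_T F G r" "day_L F G" "day_R r"] assms
  unfolding day_class_def
  by (simp add: day_T_def day_L_def day_R_def day_Hom_def simplicial_setD(1)
      kernel_act_in[where p=x and q=y and r=r])

lemma on_class_day:
  assumes "\<And>x y x' y' f g \<pi> a b. f \<in> Delta x x' \<Longrightarrow> g \<in> Delta y y' \<Longrightarrow> \<pi> \<in> kernel_set x y r \<Longrightarrow>
      a \<in> level F x' \<Longrightarrow> b \<in> level G y' \<Longrightarrow>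
      h ((x, y), \<pi>, act F x x' f a, act G y y' g b) =
      h ((x', y'), kernel_act x' y' r f g (Delta_id r) \<pi>, a, b)"
    and "\<pi> \<in> kernel_set x y r" "a \<in> level F x" "b \<in> level G y"
  shows "on_class h (day_class F G r x y \<pi> a b) = h ((x, y), \<pi>, a, b)"
  unfolding day_class_def using assms
  by (intro on_class_coend) (auto simp: day_T_def day_L_def day_R_def day_Hom_def)

lemma day_act_class:
  assumes FG: "simplicial_set F" "simplicial_set G" and rho: "\<rho> \<in> Delta r' r"
    and "\<pi> \<in> kernel_set x y r" "a \<in> level F x" "b \<in> level G y"
  shows "act (day F G) r' r \<rho> (day_class F G r x y \<pi> a b) =
    day_class F G r' x y (kernel_act x y r' (Delta_id x) (Delta_id y) \<rho> \<pi>) a b"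
proof -
  define h where "h = (\<lambda>((x, y), \<pi>, a, b).
    day_class F G r' x y (kernel_act x y r' (Delta_id x) (Delta_id y) \<rho> \<pi>) a b)"
  have "on_class h (day_class F G r x y \<pi> a b) = h ((x, y), \<pi>, a, b)"
  proof (rule on_class_day)
    fix x y x' y' f g \<pi> a b
    assume *: "f \<in> Delta x x'" "g \<in> Delta y y'" "\<pi> \<in> kernel_set x y r" "a \<in> level F x'" "b \<in> level G y'"
    have "kernel_act x' y' r' f g (Delta_id r') (kernel_act x y r' (Delta_id x) (Delta_id y) \<rho> \<pi>)
        = kernel_act x' y' r' f g \<rho> \<pi>"
      using * rho by (subst kernel_act_comp[where p=x and q=y and p'=x and q'=y and r=r]) auto
    moreover have "kernel_act x' y' r' (Delta_id x') (Delta_id y') \<rho> (kernel_act x' y' r f g (Delta_id r) \<pi>)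
        = kernel_act x' y' r' f g \<rho> \<pi>"
      using * rho by (subst kernel_act_comp[where p=x and q=y and p'=x' and q'=y' and r=r]) auto
    ultimately show "h ((x, y), \<pi>, act F x x' f a, act G y y' g b) =
        h ((x', y'), kernel_act x' y' r f g (Delta_id r) \<pi>, a, b)"
      using * FG rho unfolding h_def
      by (simp add: day_class_eq kernel_act_in[OF Delta_id_in Delta_id_in, where r=r])
  qed (use assms in auto)
  then show ?thesis
    by (simp add: day_def h_def)
qed

lemma simplicial_set_day:
  assumes FG: "simplicial_set F" "simplicial_set G"
  shows "simplicial_set (day F G)"
  unfolding simplicial_set_def
proof (intro conjI allI ballI)
  fix m n f assume f: "f \<in> Delta m n"
  show "act (day F G) m n f \<in> level (day F G) n \<rightarrow> level (day F G) m"
  proof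
    fix z assume "z \<in> level (day F G) n"
    then show "act (day F G) m n f z \<in> level (day F G) m"
      by (rule dayE) (use f FG in \<open>auto simp: day_act_class intro!: day_classI kernel_act_in\<close>)
  qed
next
  fix n z assume "z \<in> level (day F G) n"
  then show "act (day F G) n n (Delta_id n) z = z"
    by (rule dayE) (use FG in \<open>auto simp: day_act_class kernel_act_id\<close>)
next
  fix k m n f g z
  assume *: "f \<in> Delta k m" "g \<in> Delta m n" and "z \<in> level (day F G) n"
  from this(3) show "act (day F G) k n (compose {..k} g f) z =
      act (day F G) k m f (act (day F G) m n g z)"
  proof (rule dayE)
    fix x y \<pi> a b
    assume z: "\<pi> \<in> kernel_set x y n" "a \<in> level F x" "b \<in> level G y" "z = day_class F G n x y \<pi> a b"
    have "kernel_act x y k (Delta_id x) (Delta_id y) f (kernel_act x y m (Delta_id x) (Delta_id y) g \<pi>)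
      = kernel_act x y k (Delta_id x) (Delta_id y) (compose {..k} g f) \<pi>"
      using * z by (subst kernel_act_comp[where p=x and q=y and p'=x and q'=y and r=n]) auto
    then show ?thesis
      using * z FG by (simp add: day_act_class[where r=n] day_act_class[where r=m]
          Delta_comp_in kernel_act_in[OF Delta_id_in Delta_id_in, where r=n])
  qed
qed


section \<open>The Hadamard map and the canonical identification\<close>

definition hadamard :: "nat \<Rightarrow> (nat \<Rightarrow> nat) \<Rightarrow> (nat \<Rightarrow> nat) \<Rightarrow> nat \<Rightarrow> nat" where
  "hadamard m \<alpha> \<beta> = (\<lambda>t\<in>{..m}. \<alpha> t * \<beta> t)"

definition hadamard_map ::
  "nat \<Rightarrow> nat \<Rightarrow> nat \<Rightarrow> (nat \<Rightarrow> nat) \<times> (nat \<Rightarrow> nat) \<Rightarrow> nat \<Rightarrow> nat" where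
  "hadamard_map p q m = (\<lambda>(\<alpha>, \<beta>)\<in>Delta m p \<times> Delta m q. hadamard m \<alpha> \<beta>)"

definition delta :: "nat \<Rightarrow> nat \<Rightarrow> nat \<Rightarrow> kernel_elem \<Rightarrow> nat \<Rightarrow> nat" where
  "delta p q r = (\<lambda>\<pi>\<in>kernel_set p q r.
     on_class (\<lambda>(m, \<sigma>, \<tau>, \<gamma>). compose {..r} (hadamard m \<sigma> \<tau>) \<gamma>) \<pi>)"

text \<open>The two co-Yoneda isomorphisms, and their composite.\<close>

definition coyoneda_day ::
  "nat \<Rightarrow> nat \<Rightarrow> nat \<Rightarrow> (nat \<Rightarrow> nat, nat \<Rightarrow> nat) day_elem \<Rightarrow> kernel_elem" where
  "coyoneda_day p q r = (\<lambda>z\<in>level (day (representable p) (representable q)) r.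
     on_class (\<lambda>((x, y), \<pi>, \<alpha>, \<beta>). kernel_act p q r \<alpha> \<beta> (Delta_id r) \<pi>) z)"

definition coyoneda_kernel ::
  "nat \<Rightarrow> nat \<Rightarrow> nat \<Rightarrow> kernel_elem \<Rightarrow> (nat \<Rightarrow> nat) \<times> (nat \<Rightarrow> nat)" where
  "coyoneda_kernel p q r = (\<lambda>\<pi>\<in>kernel_set p q r.
     on_class (\<lambda>(m, \<sigma>, \<tau>, \<gamma>). (compose {..r} \<sigma> \<gamma>, compose {..r} \<tau> \<gamma>)) \<pi>)"

definition canonical_iso :: "nat \<Rightarrow> nat \<Rightarrow> nat \<Rightarrow>
    (nat \<Rightarrow> nat, nat \<Rightarrow> nat) day_elem \<Rightarrow> (nat \<Rightarrow> nat) \<times> (nat \<Rightarrow> nat)" where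
  "canonical_iso p q =
     sset_comp (day (representable p) (representable q)) (coyoneda_kernel p q) (coyoneda_day p q)"

lemma hadamard_in:
  assumes "\<alpha> \<in> Delta m p" "\<beta> \<in> Delta m q"
  shows "hadamard m \<alpha> \<beta> \<in> Delta m (p * q)"
  using assms unfolding Delta_def hadamard_def
  by (auto simp: PiE_iff monotone_on_def intro!: mult_le_mono)

lemma hadamard_comp:
  assumes "f \<in> Delta k m"
  shows "compose {..k} (hadamard m \<alpha> \<beta>) f = hadamard k (compose {..k} \<alpha> f) (compose {..k} \<beta> f)"
  using Delta_funcset[OF assms] by (auto simp: hadamard_def compose_def fun_eq_iff Pi_iff)

lemma hadamard_map_hom:
  "hadamard_map p q \<in>
     sset_hom (sset_prod (representable p) (representable q)) (representable (p * q))"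
  unfolding sset_hom_def sset_prod_def representable_def hadamard_map_def
  by (auto simp: hadamard_in hadamard_comp Delta_comp_in PiE_iff)

lemma delta_class:
  assumes "\<sigma> \<in> Delta m p" "\<tau> \<in> Delta m q" "\<gamma> \<in> Delta r m"
  shows "delta p q r (kernel_class p q r m \<sigma> \<tau> \<gamma>) = compose {..r} (hadamard m \<sigma> \<tau>) \<gamma>"
  using assms unfolding delta_def
  by (simp add: kernel_classI, subst on_class_kernel)
    (auto simp: hadamard_comp[symmetric] Delta_comp_assoc)

lemma delta_hom: "delta p q \<in> sset_hom (kernel_sset p q) (representable (p * q))"
proof -
  have "delta p q r \<pi> \<in> Delta r (p * q)" if "\<pi> \<in> kernel_set p q r" for r \<pi>
    using that by (rule kernelE) (auto simp: delta_class intro!: Delta_comp_in hadamard_in)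
  moreover have "delta p q m (kernel_act p q m (Delta_id p) (Delta_id q) f \<pi>) =
      compose {..m} (delta p q n \<pi>) f" if "f \<in> Delta m n" "\<pi> \<in> kernel_set p q n" for m n f \<pi>
    using that(2)
    by (rule kernelE)
      (use that in \<open>auto simp: kernel_act_class delta_class Delta_comp_in Delta_comp_assoc\<close>)
  moreover have "delta p q r \<in> extensional (kernel_set p q r)" for r
    unfolding delta_def by simp
  ultimately show ?thesis
    unfolding sset_hom_def kernel_sset_def representable_def by (auto simp: PiE_iff)
qed

lemma coyoneda_kernel_class:
  assumes "\<sigma> \<in> Delta m p" "\<tau> \<in> Delta m q" "\<gamma> \<in> Delta r m"
  shows "coyoneda_kernel p q r (kernel_class p q r m \<sigma> \<tau> \<gamma>) =
    (compose {..r} \<sigma> \<gamma>, compose {..r} \<tau> \<gamma>)"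
  using assms unfolding coyoneda_kernel_def
  by (simp add: kernel_classI, subst on_class_kernel) (auto simp: Delta_comp_assoc)

lemma kernel_class_normal:
  assumes "\<sigma> \<in> Delta m p" "\<tau> \<in> Delta m q" "\<gamma> \<in> Delta r m"
  shows "kernel_class p q r m \<sigma> \<tau> \<gamma> =
    kernel_class p q r r (compose {..r} \<sigma> \<gamma>) (compose {..r} \<tau> \<gamma>) (Delta_id r)"
  using assms kernel_class_eq[of \<gamma> r m \<sigma> p \<tau> q "Delta_id r" r] by simp

lemma coyoneda_kernel_iso:
  "coyoneda_kernel p q \<in>
     sset_iso (kernel_sset p q) (sset_prod (representable p) (representable q))"
proof -
  have 1: "coyoneda_kernel p q r \<pi> \<in> Delta r p \<times> Delta r q" if "\<pi> \<in> kernel_set p q r" for r \<pi>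
    using that by (rule kernelE) (auto simp: coyoneda_kernel_class intro!: Delta_comp_in)
  have 2: "coyoneda_kernel p q m (kernel_act p q m (Delta_id p) (Delta_id q) f \<pi>) =
      (case coyoneda_kernel p q n \<pi> of (a, b) \<Rightarrow> (compose {..m} a f, compose {..m} b f))"
    if "f \<in> Delta m n" "\<pi> \<in> kernel_set p q n" for m n f \<pi>
    using that(2)
    by (rule kernelE)
      (use that in \<open>auto simp: kernel_act_class coyoneda_kernel_class Delta_comp_in Delta_comp_assoc\<close>)
  have 3: "coyoneda_kernel p q r \<in> extensional (kernel_set p q r)" for r
    unfolding coyoneda_kernel_def by simp
  have 4: "bij_betw (coyoneda_kernel p q r) (kernel_set p q r) (Delta r p \<times> Delta r q)" for r
  proof (rule bij_betw_byWitness[where f' = "\<lambda>(a, b). kernel_class p q r r a b (Delta_id r)"])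
    show "\<forall>\<pi>\<in>kernel_set p q r.
        (case coyoneda_kernel p q r \<pi> of (a, b) \<Rightarrow> kernel_class p q r r a b (Delta_id r)) = \<pi>"
    proof
      fix \<pi> assume "\<pi> \<in> kernel_set p q r"
      then show "(case coyoneda_kernel p q r \<pi> of (a, b) \<Rightarrow> kernel_class p q r r a b (Delta_id r)) = \<pi>"
        by (rule kernelE) (simp add: coyoneda_kernel_class kernel_class_normal[symmetric])
    qed
  next
    show "coyoneda_kernel p q r ` kernel_set p q r \<subseteq> Delta r p \<times> Delta r q"
      using 1 by blast
  qed (auto simp: coyoneda_kernel_class kernel_classI)
  show ?thesis
    using 1 2 3 4 unfolding sset_iso_def sset_hom_def kernel_sset_def sset_prod_def representable_def
    by (simp add: PiE_iff)
qed

lemma coyoneda_day_class: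
  assumes "\<pi> \<in> kernel_set x y r" "\<alpha> \<in> Delta x p" "\<beta> \<in> Delta y q"
  shows "coyoneda_day p q r (day_class (representable p) (representable q) r x y \<pi> \<alpha> \<beta>) =
    kernel_act p q r \<alpha> \<beta> (Delta_id r) \<pi>"
proof -
  have "day_class (representable p) (representable q) r x y \<pi> \<alpha> \<beta>
      \<in> level (day (representable p) (representable q)) r"
    using assms by (intro day_classI) (auto simp: representable_def)
  then show ?thesis
    unfolding coyoneda_day_def using assms
    by (simp, subst on_class_day)
      (auto simp: representable_def kernel_act_comp[where r=r])
qed

lemma coyoneda_day_iso:
  "coyoneda_day p q \<in>
     sset_iso (day (representable p) (representable q)) (kernel_sset p q)"
proof -
  let ?D = "day (representable p) (representable q)"
  let ?c = "day_class (representable p) (representable q)"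
  note ss = simplicial_set_representable
  have rep: "level (representable n) m = Delta m n" "act (representable n) k m f a = compose {..k} a f"
    for n m k f a by (simp_all add: representable_def)
  have 1: "coyoneda_day p q r z \<in> kernel_set p q r" if "z \<in> level ?D r" for r z
    using that
    by (rule dayE) (auto simp: rep coyoneda_day_class intro!: kernel_act_in)
  have 2: "coyoneda_day p q m (act ?D m n f z) =
      kernel_act p q m (Delta_id p) (Delta_id q) f (coyoneda_day p q n z)"
    if f: "f \<in> Delta m n" and z: "z \<in> level ?D n" for m n f z
    using z
  proof (rule dayE)
    fix x y \<pi> a b
    assume *: "\<pi> \<in> kernel_set x y n" "a \<in> level (representable p) x" "b \<in> level (representable q) y"
      "z = ?c n x y \<pi> a b"
    then have ab: "a \<in> Delta x p" "b \<in> Delta y q" by (simp_all add: rep)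
    have "kernel_act p q m a b (Delta_id m) (kernel_act x y m (Delta_id x) (Delta_id y) f \<pi>)
      = kernel_act p q m a b f \<pi>"
      using * ab f by (subst kernel_act_comp[where p=x and q=y and p'=x and q'=y and r=n]) auto
    moreover have "kernel_act p q m (Delta_id p) (Delta_id q) f (kernel_act p q n a b (Delta_id n) \<pi>)
      = kernel_act p q m a b f \<pi>"
      using * ab f by (subst kernel_act_comp[where p=x and q=y and p'=p and q'=q and r=n]) auto
    ultimately show ?thesis
      using * ab f by (simp add: day_act_class[OF ss ss] coyoneda_day_class
          kernel_act_in[OF Delta_id_in Delta_id_in, where r=n])
  qed
  have 3: "coyoneda_day p q r \<in> extensional (level ?D r)" for r
    unfolding coyoneda_day_def by simp
  have 4: "bij_betw (coyoneda_day p q r) (level ?D r) (kernel_set p q r)" for r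
  proof (rule bij_betw_byWitness[where f' = "\<lambda>\<pi>. ?c r p q \<pi> (Delta_id p) (Delta_id q)"])
    show "\<forall>z\<in>level ?D r. ?c r p q (coyoneda_day p q r z) (Delta_id p) (Delta_id q) = z"
    proof
      fix z assume "z \<in> level ?D r"
      then show "?c r p q (coyoneda_day p q r z) (Delta_id p) (Delta_id q) = z"
      proof (rule dayE)
        fix x y \<pi> a b
        assume *: "\<pi> \<in> kernel_set x y r" "a \<in> level (representable p) x" "b \<in> level (representable q) y"
          "z = ?c r x y \<pi> a b"
        then have ab: "a \<in> Delta x p" "b \<in> Delta y q" by (simp_all add: rep)
        have "?c r x y \<pi> a b = ?c r p q (kernel_act p q r a b (Delta_id r) \<pi>) (Delta_id p) (Delta_id q)"
          using ab day_class_eq[OF ss ss ab *(1), of "Delta_id p" p "Delta_id q" q]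
          by (simp add: rep)
        moreover have "coyoneda_day p q r z = kernel_act p q r a b (Delta_id r) \<pi>"
          unfolding *(4) by (rule coyoneda_day_class[OF *(1) ab])
        ultimately show ?thesis
          using *(4) by simp
      qed
    qed
  next
    show "\<forall>\<pi>\<in>kernel_set p q r. coyoneda_day p q r (?c r p q \<pi> (Delta_id p) (Delta_id q)) = \<pi>"
      by (simp add: coyoneda_day_class kernel_act_id)
  next
    show "(\<lambda>\<pi>. ?c r p q \<pi> (Delta_id p) (Delta_id q)) ` kernel_set p q r \<subseteq> level ?D r"
      by (auto intro!: day_classI simp: rep)
  qed (use 1 in auto)
  show ?thesis
    using 1 2 3 4 unfolding sset_iso_def sset_hom_def kernel_sset_def by (simp add: PiE_iff)
qed

lemma canonical_iso_iso:
  "canonical_iso p q \<in> sset_iso (day (representable p) (representable q))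
     (sset_prod (representable p) (representable q))"
  unfolding canonical_iso_def
  by (rule sset_comp_iso[OF _ coyoneda_day_iso coyoneda_kernel_iso])
    (intro simplicial_set_day simplicial_set_representable)

end

theory Submission
  imports Defs
begin

text \<open>Moving \<open>\<gamma>\<close> inside the pointwise product,
  \<open>(\<sigma> \<boxtimes> \<tau>) \<circ> \<gamma> = (\<sigma> \<circ> \<gamma>) \<boxtimes> (\<tau> \<circ> \<gamma>)\<close>, so \<open>\<delta>\<close> is the Hadamard map precomposed with the
  second co-Yoneda isomorphism.  Hence \<open>H\<close> composed with the canonical identification takes the
  prescribed values on the classes \<open>[\<pi>; \<alpha>, \<beta>]\<close>, and these classes exhaust the Day convolution.\<close>

lemma hadamard_map_coyoneda_kernel:
  assumes "\<pi> \<in> kernel_set p q r"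
  shows "hadamard_map p q r (coyoneda_kernel p q r \<pi>) = delta p q r \<pi>"
  using assms
  by (rule kernelE)
    (auto simp: hadamard_map_def coyoneda_kernel_class delta_class hadamard_comp Delta_comp_in)

lemma level_representable: "level (representable n) m = Delta m n"
  by (simp add: representable_def)

lemma canonical_iso_day_class:
  assumes "\<pi> \<in> kernel_set x y r" "\<alpha> \<in> Delta x p" "\<beta> \<in> Delta y q"
  shows "canonical_iso p q r (day_class (representable p) (representable q) r x y \<pi> \<alpha> \<beta>) =
    coyoneda_kernel p q r (kernel_act p q r \<alpha> \<beta> (Delta_id r) \<pi>)"
  using assms unfolding canonical_iso_def sset_comp_def
  by (simp add: compose_def coyoneda_day_class day_classI level_representable)

text \<open>Components are extensional and, by \<open>dayE\<close>, every element of a level is a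
  class \<open>[\<pi>; a, b]\<close>. This serves the uniqueness of \<open>\<Theta>\<close>.\<close>

lemma day_hom_eqI:
  assumes "\<theta> \<in> sset_hom (day F G) X" "\<eta> \<in> sset_hom (day F G) X"
    and eq: "\<And>r x y \<pi> a b. \<pi> \<in> kernel_set x y r \<Longrightarrow> a \<in> level F x \<Longrightarrow> b \<in> level G y \<Longrightarrow>
      \<theta> r (day_class F G r x y \<pi> a b) = \<eta> r (day_class F G r x y \<pi> a b)"
  shows "\<theta> = \<eta>"
proof
  fix r
  have "\<theta> r \<in> level (day F G) r \<rightarrow>\<^sub>E level X r" "\<eta> r \<in> level (day F G) r \<rightarrow>\<^sub>E level X r"
    using assms(1,2) unfolding sset_hom_def by blast+
  then show "\<theta> r = \<eta> r"
    by (rule PiE_ext) (auto elim!: dayE intro: eq)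
qed

theorem proposition3:
  fixes p q :: nat
  shows "\<exists>\<Theta> \<in> sset_hom (day (representable p) (representable q)) (representable (p * q)).
    (\<forall>r x y. \<forall>\<pi>\<in>kernel_set x y r. \<forall>\<alpha>\<in>Delta x p. \<forall>\<beta>\<in>Delta y q.
       \<Theta> r (day_class (representable p) (representable q) r x y \<pi> \<alpha> \<beta>) =
       delta p q r (kernel_act p q r \<alpha> \<beta> (Delta_id r) \<pi>)) \<and>
    (\<forall>\<Theta>' \<in> sset_hom (day (representable p) (representable q)) (representable (p * q)).
       (\<forall>r x y. \<forall>\<pi>\<in>kernel_set x y r. \<forall>\<alpha>\<in>Delta x p. \<forall>\<beta>\<in>Delta y q.
          \<Theta>' r (day_class (representable p) (representable q) r x y \<pi> \<alpha> \<beta>) =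
          delta p q r (kernel_act p q r \<alpha> \<beta> (Delta_id r) \<pi>)) \<longrightarrow> \<Theta>' = \<Theta>) \<and>
    \<Theta> = sset_comp (day (representable p) (representable q)) (hadamard_map p q) (canonical_iso p q)"
proof -
  let ?D = "day (representable p) (representable q)"
  let ?c = "day_class (representable p) (representable q)"
  \<comment> \<open>Composing known maps, instead of descending from representatives, makes
    well-definedness and naturality of \<open>\<Theta>\<close> automatic.\<close>
  define \<Theta> where "\<Theta> = sset_comp ?D (hadamard_map p q) (canonical_iso p q)"
  have hom: "\<Theta> \<in> sset_hom ?D (representable (p * q))"
    unfolding \<Theta>_def using canonical_iso_iso hadamard_map_hom
    by (intro sset_comp_hom simplicial_set_day simplicial_set_representable)
      (auto simp: sset_iso_def)
  \<comment> \<open>The first co-Yoneda map sends the class to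
    \<open>P(\<alpha>, \<beta>; [r])(\<pi>)\<close>; on such kernel elements \<open>\<delta>\<close>
    is \<open>H\<close> after the second one.\<close>
  have val: "\<Theta> r (?c r x y \<pi> \<alpha> \<beta>) = delta p q r (kernel_act p q r \<alpha> \<beta> (Delta_id r) \<pi>)"
    if "\<pi> \<in> kernel_set x y r" "\<alpha> \<in> Delta x p" "\<beta> \<in> Delta y q" for r x y \<pi> \<alpha> \<beta>
    using that unfolding \<Theta>_def sset_comp_def
    by (simp add: compose_def day_classI level_representable canonical_iso_day_class
        hadamard_map_coyoneda_kernel kernel_act_in[where r = r])
  show ?thesis
    unfolding \<Theta>_def[symmetric]
    \<comment> \<open>For uniqueness, \<open>val\<close> shows that both maps have the prescribed
      values on classes.\<close>
    by (intro bexI[OF _ hom] conjI ballI allI impI refl day_hom_eqI[OF _ hom])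
      (auto simp: val level_representable)
qed

end
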